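(* The generating functions $M_{\mathrm I}^+(x,y;t)$ and $M_{\mathrm{II}}^+(x,y;t)$ of Motzkin N-meanders of type I and type II, respectively, are algebraic. In particular, the generating function $M^+(x,y;t)=M_{\mathrm I}^+(x,y;t)+M_{\mathrm{II}}^+(x,y;t)$ of Motzkin N-meanders, and the N-excursion generating functions $M_{\mathrm I}^+(0,y;t)$, $M_{\mathrm{II}}^+(0,y;t)$, are algebraic.
   Context: An N-step is a non-empty finite set of integers. Motzkin N-walks are finite sequences $w=(s_1,\dots,s_n)$ of N-steps from $S_M=\{\{-1\},\{0\},\{1\},\{-1,0\},\{-1,1\},\{0,1\},\{-1,0,1\}\}$, starting at $0$, with length $|w|=n$. A classical walk $(v_1,\dots,v_n)$ of integers with positions $\omega_k=\sum_{i\le k}v_i$ is compatible with $w$ if $v_i\in s_i$ for all $i$; it is a meander if $\omega_k\ge 0$ for all $k$. An N-meander is an N-walk compatible with at least one meander; its reachable points are the endpoints $\omega_n$ of all compatible meanders, with minimum $\min^+(w)$ and maximum $\max^+(w)$. A set $R$ of reachable points with minimum $a$ and maximum $b$ is of type I if $R=\{a+i: i=0,1,\dots,b-a\}$ and $b-a\ge1$, and of type II if $R=\{a+2i: i=0,1,\dots,(b-a)/2\}$. An N-meander is of type I/II if its set of reachable points is. Then $M_{\mathrm I}^+(x,y;t)=\sum_w x^{\min^+(w)}y^{\max^+(w)}t^{|w|}$ over Motzkin N-meanders $w$ of type I, and $M_{\mathrm{II}}^+$ likewise for type II (unweighted). *)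

theory Defs
  imports Complex_Main "HOL-Computational_Algebra.Computational_Algebra"
begin

type_synonym N_walk = "int set list"

definition motzkin_N_steps :: "int set set" where
  "motzkin_N_steps = {{-1}, {0}, {1}, {-1, 0}, {-1, 1}, {0, 1}, {-1, 0, 1}}"

definition compatible :: "int list \<Rightarrow> N_walk \<Rightarrow> bool" where
  "compatible v w \<longleftrightarrow> list_all2 (\<in>) v w"

definition meander :: "int list \<Rightarrow> bool" where
  "meander v \<longleftrightarrow> (\<forall>k \<le> length v. 0 \<le> sum_list (take k v))"

definition N_meander :: "N_walk \<Rightarrow> bool" where
  "N_meander w \<longleftrightarrow> (\<exists>v. compatible v w \<and> meander v)"

definition reachable :: "N_walk \<Rightarrow> int set" where
  "reachable w = {sum_list v | v. compatible v w \<and> meander v}"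

definition min_plus :: "N_walk \<Rightarrow> int" where
  "min_plus w = Min (reachable w)"

definition max_plus :: "N_walk \<Rightarrow> int" where
  "max_plus w = Max (reachable w)"

definition type_I :: "int set \<Rightarrow> bool" where
  "type_I R \<longleftrightarrow> (let a = Min R; b = Max R in
     R = {a + i | i. 0 \<le> i \<and> i \<le> b - a} \<and> b - a \<ge> 1)"

text \<open>For odd \<open>b - a\<close> the rounding in \<open>div\<close> is harmless: the set on the right-hand side then
  does not contain the maximum \<open>b\<close> of \<open>R\<close>, so the equation fails.\<close>

definition type_II :: "int set \<Rightarrow> bool" where
  "type_II R \<longleftrightarrow> (let a = Min R; b = Max R in
     R = {a + 2 * i | i. 0 \<le> i \<and> i \<le> (b - a) div 2})"

definition motzkin_N_meanders :: "N_walk set" where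
  "motzkin_N_meanders = {w \<in> lists motzkin_N_steps. N_meander w}"

definition motzkin_N_meanders_I :: "N_walk set" where
  "motzkin_N_meanders_I = {w \<in> motzkin_N_meanders. type_I (reachable w)}"

definition motzkin_N_meanders_II :: "N_walk set" where
  "motzkin_N_meanders_II = {w \<in> motzkin_N_meanders. type_II (reachable w)}"

text \<open>Trivariate generating functions are power series in \<open>t\<close> whose coefficients are polynomials
  in \<open>x\<close> (the outer variable) over polynomials in \<open>y\<close> (the inner variable), so that
  \<open>monom (monom 1 b) a\<close> is the monomial \<open>x\<^sup>a y\<^sup>b\<close>. Reachable points are nonnegative, hence \<open>nat\<close>
  loses nothing.\<close>

definition walk_gf :: "N_walk set \<Rightarrow> rat poly poly fps" where
  "walk_gf A = Abs_fps (\<lambda>n. \<Sum>w \<in> {w \<in> A. length w = n}.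
     monom (monom 1 (nat (max_plus w))) (nat (min_plus w)))"

definition M_plus :: "rat poly poly fps" where
  "M_plus = walk_gf motzkin_N_meanders"

definition M_plus_I :: "rat poly poly fps" where
  "M_plus_I = walk_gf motzkin_N_meanders_I"

definition M_plus_II :: "rat poly poly fps" where
  "M_plus_II = walk_gf motzkin_N_meanders_II"

definition at_x_0 :: "rat poly poly fps \<Rightarrow> rat poly fps" where
  "at_x_0 F = Abs_fps (\<lambda>n. poly (fps_nth F n) 0)"

text \<open>A power series in \<open>t\<close> over a domain \<open>D\<close> is algebraic if it is a root of a nonzero polynomial
  with coefficients in \<open>D[t]\<close>; clearing denominators, this is algebraicity over the fraction field
  of \<open>D[t]\<close>. For \<open>D\<close> the ring \<open>rat poly poly\<close> this field is the field of rational functions in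
  \<open>x, y, t\<close> over the rationals, and for \<open>rat poly\<close> the one in \<open>y, t\<close>.\<close>

definition algebraic_fps :: "'a::idom fps \<Rightarrow> bool" where
  "algebraic_fps F \<longleftrightarrow> (\<exists>P :: 'a poly poly. P \<noteq> 0 \<and> poly (map_poly fps_of_poly P) F = 0)"

end

theory Submission
  imports Defs
begin

text \<open>Put \<open>u = x y\<close> and record a reachable set by its minimum and its width. The two series then become
  \<open>A(u, y)\<close> for type II, and \<open>y B(u, y)\<close> for type I, where the width is decreased by one. Appending
  one step couples them linearly, with two quadratic kernels and the boundary series \<open>A(0, y)\<close>,
  \<open>B(0, y)\<close>, \<open>A(0, 0)\<close>, \<open>B(0, 0)\<close>. In the coordinates \<open>(u, y)\<close> the small roots \<open>U\<close> and \<open>Z\<close> of the two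
  kernels are power series in \<open>t\<close> over the polynomials in \<open>y\<close>. Setting \<open>u = y = Y\<close> with
  \<open>Y = t (1 + 2 Y + 4 Y\<^sup>2)\<close> gives \<open>t A(0, 0) = Y\<close>; setting \<open>u = y = W\<close> with \<open>W = t (1 + W + 2 W\<^sup>2)\<close> gives
  \<open>B(0, 0)\<close>; setting \<open>u = U\<close> and \<open>u = Z\<close> gives \<open>A(0, y)\<close> and \<open>B(0, y)\<close>. Each step only uses field
  operations on algebraic series.\<close>

section \<open>Algebraic elements\<close>

text \<open>Gaussian elimination without division: a pivot \<open>p\<close> with
  \<open>v p k \<noteq> 0\<close> clears coordinate \<open>k\<close> by cross-multiplication, so all
  coefficients stay in the domain.\<close>

lemma linear_dependence:
  fixes v :: "'i \<Rightarrow> 'j \<Rightarrow> 'r::idom"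
  assumes "finite J" "finite I" "card J < card I"
  shows "\<exists>c. (\<exists>i\<in>I. c i \<noteq> 0) \<and> (\<forall>j\<in>J. (\<Sum>i\<in>I. c i * v i j) = 0)"
  using assms
proof (induction J arbitrary: I v rule: finite_induct)
  case empty
  then have "I \<noteq> {}" by auto
  then show ?case by (intro exI[of _ "\<lambda>_. 1"]) auto
next
  case (insert k J)
  show ?case
  proof (cases "\<forall>i\<in>I. v i k = 0")
    case True
    obtain c where "\<exists>i\<in>I. c i \<noteq> 0" "\<forall>j\<in>J. (\<Sum>i\<in>I. c i * v i j) = 0"
      using insert.IH[of I v] insert.prems insert.hyps by auto
    then show ?thesis using True by (intro exI[of _ c]) auto
  next
    case False
    then obtain p where p: "p \<in> I" "v p k \<noteq> 0" by blast
    have card: "card J < card (I - {p})"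
      using insert.prems insert.hyps p by simp
    define v' where "v' i j = v p k * v i j - v i k * v p j" for i j
    obtain c where c: "\<exists>i\<in>I - {p}. c i \<noteq> 0" "\<forall>j\<in>J. (\<Sum>i\<in>I - {p}. c i * v' i j) = 0"
      using insert.IH[of "I - {p}" v'] insert.prems card by auto
    define d where "d i = (if i = p then - (\<Sum>i\<in>I - {p}. c i * v i k) else c i * v p k)" for i
    have sum_d: "(\<Sum>i\<in>I. d i * v i j) = (\<Sum>i\<in>I - {p}. c i * v' i j)" for j
    proof -
      have "(\<Sum>i\<in>I. d i * v i j) = d p * v p j + (\<Sum>i\<in>I - {p}. d i * v i j)"
        using insert.prems p by (simp add: sum.remove)
      also have "(\<Sum>i\<in>I - {p}. d i * v i j) = (\<Sum>i\<in>I - {p}. c i * v p k * v i j)"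
        by (rule sum.cong) (auto simp: d_def)
      also have "d p * v p j = - (\<Sum>i\<in>I - {p}. c i * v i k * v p j)"
        by (simp add: d_def sum_distrib_right)
      finally show ?thesis
        by (simp add: v'_def sum_subtractf algebra_simps)
    qed
    have "\<exists>i\<in>I. d i \<noteq> 0" using c(1) p by (auto simp: d_def)
    moreover have "(\<Sum>i\<in>I. d i * v i k) = 0"
      unfolding sum_d by (simp add: v'_def mult.commute)
    ultimately show ?thesis using c(2) sum_d by (intro exI[of _ d]) auto
  qed
qed

locale inj_ring_hom =
  fixes h :: "'r::idom \<Rightarrow> 's::idom"
  assumes hom_add: "h (x + y) = h x + h y"
    and hom_mult: "h (x * y) = h x * h y"
    and hom_1: "h 1 = 1"
    and hom_eq_0_iff: "h x = 0 \<longleftrightarrow> x = 0"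
begin

lemma hom_0: "h 0 = 0"
  by (simp add: hom_eq_0_iff)

lemma hom_power: "h (x ^ n) = h x ^ n"
  by (induction n) (simp_all add: hom_1 hom_mult)

lemma hom_uminus: "h (- x) = - h x"
  using hom_add[of x "- x"] by (simp add: hom_0 eq_neg_iff_add_eq_0 add.commute)

lemma hom_sum: "h (sum f A) = (\<Sum>i\<in>A. h (f i))"
  by (induction A rule: infinite_finite_induct) (simp_all add: hom_0 hom_add)

sublocale module "\<lambda>r x. h r * x"
  by unfold_locales (simp_all add: algebra_simps hom_add hom_mult hom_1)

declare scale_scale [simp del]

definition alg :: "'s \<Rightarrow> bool" where
  "alg F \<longleftrightarrow> (\<exists>P. P \<noteq> 0 \<and> poly (map_poly h P) F = 0)"

text \<open>An element is algebraic iff it acts, up to a denominator, on a nonzero finitely generated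
  module. Two elements act on the product of their modules, and so do their sum and product.\<close>

definition acts :: "'s \<Rightarrow> 's set \<Rightarrow> bool" where
  "acts F B \<longleftrightarrow> (\<exists>r. r \<noteq> 0 \<and> (\<forall>x\<in>span B. h r * F * x \<in> span B))"

lemma actsI:
  assumes "r \<noteq> 0" "\<And>x. x \<in> B \<Longrightarrow> h r * F * x \<in> span B"
  shows "acts F B"
  unfolding acts_def
proof (intro exI[of _ r] conjI ballI)
  fix x assume "x \<in> span B"
  then show "h r * F * x \<in> span B"
  proof (induction rule: span_induct_alt)
    case base
    then show ?case by (simp add: span_zero)
  next
    case (step c x y)
    have "h c * (h r * F * x) + h r * F * y \<in> span B"
      by (intro span_add span_scale assms step)
    then show ?case by (simp add: algebra_simps)
  qed
qed (fact assms)

lemma acts_add: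
  assumes "acts F B" "acts G B"
  shows "acts (F + G) B"
proof -
  obtain a b where a: "a \<noteq> 0" "\<And>x. x \<in> span B \<Longrightarrow> h a * F * x \<in> span B"
    and b: "b \<noteq> 0" "\<And>x. x \<in> span B \<Longrightarrow> h b * G * x \<in> span B"
    using assms by (auto simp: acts_def)
  show ?thesis
  proof (rule actsI[of "a * b"])
    fix x assume "x \<in> B"
    then have x: "x \<in> span B" by (rule span_base)
    have "h b * (h a * F * x) + h a * (h b * G * x) \<in> span B"
      by (intro span_add span_scale a b x)
    then show "h (a * b) * (F + G) * x \<in> span B" by (simp add: hom_mult algebra_simps)
  qed (use a b in simp)
qed

lemma acts_mult:
  assumes "acts F B" "acts G B"
  shows "acts (F * G) B"
proof -
  obtain a b where a: "a \<noteq> 0" "\<And>x. x \<in> span B \<Longrightarrow> h a * F * x \<in> span B"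
    and b: "b \<noteq> 0" "\<And>x. x \<in> span B \<Longrightarrow> h b * G * x \<in> span B"
    using assms by (auto simp: acts_def)
  show ?thesis
  proof (rule actsI[of "a * b"])
    fix x assume "x \<in> B"
    then have "h a * F * (h b * G * x) \<in> span B"
      by (intro a b span_base)
    then show "h (a * b) * (F * G) * x \<in> span B" by (simp add: hom_mult algebra_simps)
  qed (use a b in simp)
qed

text \<open>The factor \<open>h r\<close> is absorbed into the denominator; this is the division
  step in \<open>alg_quotient\<close>.\<close>

lemma acts_cancel:
  assumes "acts (h r * F) B" "r \<noteq> 0"
  shows "acts F B"
proof -
  obtain a where a: "a \<noteq> 0" "\<And>x. x \<in> span B \<Longrightarrow> h a * (h r * F) * x \<in> span B"
    using assms(1) by (auto simp: acts_def)
  then show ?thesis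
    using assms(2) by (intro actsI[of "a * r"]) (simp_all add: span_base hom_mult mult.assoc)
qed

lemma acts_product_set:
  assumes "acts F B"
  shows "acts F {b * c | b c. b \<in> B \<and> c \<in> C}"
proof -
  let ?BC = "{b * c | b c. b \<in> B \<and> c \<in> C}"
  obtain r where r: "r \<noteq> 0" "\<And>x. x \<in> span B \<Longrightarrow> h r * F * x \<in> span B"
    using assms by (auto simp: acts_def)
  have mult: "x * c \<in> span ?BC" if "x \<in> span B" "c \<in> C" for x c
    using that(1)
  proof (induction rule: span_induct_alt)
    case base
    then show ?case by (simp add: span_zero)
  next
    case (step s x y)
    have "x * c \<in> ?BC" using step that by blast
    then have "h s * (x * c) + y * c \<in> span ?BC"
      using step(2) by (intro span_add[OF span_scale[OF span_base]])
    then show ?case by (simp add: algebra_simps)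
  qed
  show ?thesis
  proof (rule actsI[OF r(1)])
    fix x assume "x \<in> ?BC"
    then obtain b c where "x = b * c" "b \<in> B" "c \<in> C" by blast
    then show "h r * F * x \<in> span ?BC"
      using mult[OF r(2)[OF span_base]] by (simp add: mult.assoc)
  qed
qed

text \<open>The powers of \<open>F\<close> below the degree span the module; the leading coefficient
  is the denominator that brings \<open>F ^ m\<close> back into it.\<close>

lemma alg_imp_acts:
  assumes "alg F"
  shows "\<exists>B. finite B \<and> (\<exists>b\<in>B. b \<noteq> 0) \<and> acts F B"
proof -
  obtain P where P: "P \<noteq> 0" "poly (map_poly h P) F = 0"
    using assms by (auto simp: alg_def)
  define m where "m = degree P"
  have deg: "degree (map_poly h P) = m"
    unfolding m_def by (rule degree_map_poly) (use P(1) in \<open>simp add: hom_eq_0_iff\<close>)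
  have sum0: "(\<Sum>i\<le>m. h (coeff P i) * F ^ i) = 0"
    using P(2) unfolding poly_altdef deg by (simp add: coeff_map_poly hom_0)
  have lead: "coeff P m \<noteq> 0" using P(1) by (simp add: m_def)
  \<comment> \<open>A nonzero constant polynomial has no root because \<open>h\<close> is injective;
    hence \<open>1\<close> is among the generators.\<close>
  have "m \<noteq> 0" using sum0 lead by (cases m) (simp_all add: hom_eq_0_iff)
  define B where "B = (\<lambda>i. F ^ i) ` {..<m}"
  have top: "h (coeff P m) * F ^ m \<in> span B"
  proof -
    have "h (coeff P m) * F ^ m = (\<Sum>i<m. h (- coeff P i) * F ^ i)"
      using sum0 by (simp add: lessThan_Suc_atMost[symmetric] hom_uminus sum_negf
          eq_neg_iff_add_eq_0 add.commute)
    also have "\<dots> \<in> span B"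
      by (intro span_sum span_scale span_base) (auto simp: B_def)
    finally show ?thesis .
  qed
  have "acts F B"
  proof (rule actsI[OF lead])
    fix x assume "x \<in> B"
    then obtain i where i: "i < m" "x = F ^ i" by (auto simp: B_def)
    have *: "h (coeff P m) * F * x = h (coeff P m) * F ^ Suc i" using i by simp
    show "h (coeff P m) * F * x \<in> span B"
    proof (cases "Suc i = m")
      case True
      then show ?thesis using top unfolding * by (simp only:)
    next
      case False
      then show ?thesis unfolding * using i
        by (intro span_scale span_base) (auto simp: B_def simp del: power_Suc)
    qed
  qed
  moreover have "1 \<in> B" using \<open>m \<noteq> 0\<close> by (auto simp: B_def intro!: image_eqI[of _ _ 0])
  ultimately show ?thesis by (intro exI[of _ B]) (auto simp: B_def)
qed

text \<open>The vectors \<open>(h r * F) ^ k * b\<close> with \<open>k \<le> card B\<close>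
  outnumber the generators, so their coordinate vectors are dependent; cancelling \<open>b\<close>
  in the domain leaves an equation for \<open>F\<close>.\<close>

lemma acts_imp_alg:
  assumes "finite B" "b \<in> B" "b \<noteq> 0" "acts F B"
  shows "alg F"
proof -
  obtain r where r: "r \<noteq> 0" "\<And>x. x \<in> span B \<Longrightarrow> h r * F * x \<in> span B"
    using assms by (auto simp: acts_def)
  have "(h r * F) ^ k * b \<in> span B" for k
  proof (induction k)
    case 0
    then show ?case using assms(2) by (simp add: span_base)
  next
    case (Suc k)
    then show ?case using r(2)[of "(h r * F) ^ k * b"] by (simp add: algebra_simps)
  qed
  then have "\<forall>k. \<exists>v. (h r * F) ^ k * b = (\<Sum>x\<in>B. h (v x) * x)"
    unfolding span_finite[OF assms(1)] by (simp add: image_iff)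
  then obtain v where v: "\<And>k. (h r * F) ^ k * b = (\<Sum>x\<in>B. h (v k x) * x)"
    using choice[of "\<lambda>k v. (h r * F) ^ k * b = (\<Sum>x\<in>B. h (v x) * x)"] by auto
  obtain c where c: "\<exists>i\<in>{..card B}. c i \<noteq> 0" "\<forall>x\<in>B. (\<Sum>i\<le>card B. c i * v i x) = 0"
    using linear_dependence[of B "{..card B}" v] assms(1) by auto
  \<comment> \<open>The factor \<open>r ^ i\<close> turns a relation between powers of
    \<open>h r * F\<close> into one between powers of \<open>F\<close>.\<close>
  define P where "P = (\<Sum>i\<le>card B. monom (c i * r ^ i) i)"
  have coeff_P: "coeff P i = (if i \<le> card B then c i * r ^ i else 0)" for i
    by (simp add: P_def coeff_sum sum.If_cases if_distrib[of "\<lambda>x. coeff x i"] cong: if_cong)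
  have "P \<noteq> 0"
  proof
    assume "P = 0"
    then have "c i * r ^ i = 0" if "i \<le> card B" for i
      using coeff_P[of i] that by simp
    then show False using c(1) r(1) by auto
  qed
  moreover have "poly (map_poly h P) F = 0"
  proof -
    have deg: "degree (map_poly h P) \<le> card B"
      by (rule degree_le) (simp add: coeff_map_poly hom_0 coeff_P)
    have "poly (map_poly h P) F = (\<Sum>i\<le>card B. coeff (map_poly h P) i * F ^ i)"
      unfolding poly_altdef using deg
      by (intro sum.mono_neutral_left) (auto simp: coeff_eq_0)
    also have "\<dots> = (\<Sum>i\<le>card B. h (c i * r ^ i) * F ^ i)"
      by (intro sum.cong) (auto simp: coeff_map_poly hom_0 coeff_P)
    finally have poly_F: "poly (map_poly h P) F = (\<Sum>i\<le>card B. h (c i * r ^ i) * F ^ i)" .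
    have "poly (map_poly h P) F * b = (\<Sum>i\<le>card B. h (c i) * ((h r * F) ^ i * b))"
      unfolding poly_F sum_distrib_right
      by (simp add: hom_mult hom_power power_mult_distrib mult_ac)
    also have "\<dots> = (\<Sum>i\<le>card B. \<Sum>x\<in>B. h (c i * v i x) * x)"
      by (simp add: v sum_distrib_left hom_mult mult.assoc)
    also have "\<dots> = (\<Sum>x\<in>B. h (\<Sum>i\<le>card B. c i * v i x) * x)"
      by (subst sum.swap) (simp add: hom_sum sum_distrib_right)
    also have "\<dots> = 0" using c(2) by (simp add: hom_0)
    finally show ?thesis using assms(3) by simp
  qed
  ultimately show ?thesis by (auto simp: alg_def)
qed

lemma common_module:
  assumes "alg F" "alg G"
  obtains B b where "finite B" "b \<in> B" "b \<noteq> 0" "acts F B" "acts G B"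
proof -
  obtain B b C c where B: "finite B" "b \<in> B" "b \<noteq> 0" "acts F B"
    and C: "finite C" "c \<in> C" "c \<noteq> 0" "acts G C"
    using assms[THEN alg_imp_acts] by blast
  let ?BC = "{b * c | b c. b \<in> B \<and> c \<in> C}"
  have "?BC = (\<lambda>(b, c). b * c) ` (B \<times> C)" by auto
  then have "finite ?BC" using B C by simp
  moreover have "?BC = {c * b | c b. c \<in> C \<and> b \<in> B}" using mult.commute by blast
  then have "acts G ?BC" using acts_product_set[OF C(4), of B] by (simp only:)
  moreover have "b * c \<in> ?BC" "b * c \<noteq> 0" using B C by auto
  ultimately show ?thesis using acts_product_set[OF B(4)] that by blast
qed

section \<open>Field operations on algebraic elements\<close>

lemma alg_add: "alg F \<Longrightarrow> alg G \<Longrightarrow> alg (F + G)"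
  by (erule (1) common_module) (rule acts_imp_alg[OF _ _ _ acts_add])

lemma alg_mult: "alg F \<Longrightarrow> alg G \<Longrightarrow> alg (F * G)"
  by (erule (1) common_module) (rule acts_imp_alg[OF _ _ _ acts_mult])

lemma alg_hom: "alg (h r)"
  unfolding alg_def
  by (intro exI[of _ "[:- r, 1:]"]) (simp add: map_poly_pCons hom_0 hom_1 hom_uminus)

lemma alg_uminus: "alg F \<Longrightarrow> alg (- F)"
  using alg_mult[OF alg_hom[of "- 1"]] by (simp add: hom_uminus hom_1)

lemma alg_diff: "alg F \<Longrightarrow> alg G \<Longrightarrow> alg (F - G)"
  using alg_add[of F "- G"] alg_uminus[of G] by simp

lemma alg_poly: "alg F \<Longrightarrow> alg (poly (map_poly h P) F)"
proof (induction P)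
  case 0
  then show ?case using alg_hom[of 0] by (simp add: hom_0)
next
  case (pCons a P)
  then show ?case by (simp add: map_poly_pCons hom_0 alg_add alg_hom alg_mult)
qed

text \<open>Factors of the variable are stripped from the annihilating polynomial until its constant
  term \<open>a\<close> is nonzero. The equation \<open>h a + G * H = 0\<close>, with
  \<open>H\<close> a polynomial in \<open>G\<close>, then makes \<open>- H\<close> a
  cofactor.\<close>

lemma alg_ex_cofactor:
  assumes "alg G" "G \<noteq> 0"
  shows "\<exists>r G'. r \<noteq> 0 \<and> alg G' \<and> G * G' = h r"
proof -
  have "\<exists>r G'. r \<noteq> 0 \<and> alg G' \<and> G * G' = h r"
    if "P \<noteq> 0" "poly (map_poly h P) G = 0" for P
    using that
  proof (induction P)
    case (pCons a P)
    have eq: "h a + G * poly (map_poly h P) G = 0"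
      using pCons.prems by (simp add: map_poly_pCons hom_0)
    show ?case
    proof (cases "a = 0")
      case True
      have "P \<noteq> 0" using True pCons.prems(1) by simp
      moreover have "poly (map_poly h P) G = 0" using eq True assms(2) by (simp add: hom_0)
      ultimately show ?thesis by (rule pCons.IH)
    next
      case False
      have "h a = - (G * poly (map_poly h P) G)"
        using eq by (simp add: eq_neg_iff_add_eq_0)
      then have "G * - poly (map_poly h P) G = h a" by simp
      then show ?thesis using False alg_uminus[OF alg_poly[OF assms(1)]] by blast
    qed
  qed simp
  then show ?thesis using assms by (auto simp: alg_def)
qed

text \<open>Division inside the ring: multiplying by the cofactor of \<open>G\<close> replaces the
  divisor by some \<open>h r\<close>, which can be cancelled.\<close>

lemma alg_quotient:
  assumes "G * F = H" "alg G" "alg H" "G \<noteq> 0"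
  shows "alg F"
proof -
  obtain r G' where r: "r \<noteq> 0" "alg G'" "G * G' = h r"
    using alg_ex_cofactor assms by blast
  have "h r * F = H * G'" unfolding r(3)[symmetric] assms(1)[symmetric] by (simp add: mult_ac)
  then have "alg (h r * F)" using alg_mult r assms by simp
  then obtain B b where "finite B" "b \<in> B" "b \<noteq> 0" "acts (h r * F) B"
    using alg_imp_acts by blast
  then show ?thesis using acts_cancel r acts_imp_alg by blast
qed

end

text \<open>The base ring is \<open>D[t]\<close> inside \<open>D[[t]]\<close>. The domain
  \<open>D\<close> stays arbitrary, to serve both \<open>rat poly poly\<close> and
  \<open>rat poly\<close>.\<close>

interpretation fps: inj_ring_hom "fps_of_poly :: 'c::idom poly \<Rightarrow> 'c fps"
  rewrites "inj_ring_hom.alg fps_of_poly = (algebraic_fps :: 'c fps \<Rightarrow> bool)"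
proof -
  show hom: "inj_ring_hom (fps_of_poly :: 'c poly \<Rightarrow> 'c fps)"
    by unfold_locales (simp_all add: fps_of_poly_add fps_of_poly_mult)
  show "inj_ring_hom.alg fps_of_poly = (algebraic_fps :: 'c fps \<Rightarrow> bool)"
    by (rule ext) (simp add: inj_ring_hom.alg_def[OF hom] algebraic_fps_def)
qed

lemma algebraic_fps_const: "algebraic_fps (fps_const c)"
  using fps.alg_hom[of "[:c:]"] by (simp add: fps_of_poly_const)

lemma algebraic_fps_X: "algebraic_fps fps_X"
  using fps.alg_hom[of "[:0, 1:]"] by (simp add: fps_of_poly_fps_X)

section \<open>Reachable sets\<close>

definition extend :: "int set \<Rightarrow> int set \<Rightarrow> int set" where
  "extend R s = {z. 0 \<le> z \<and> (\<exists>i\<in>s. z - i \<in> R)}"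

lemma compatible_snoc:
  "compatible v (w @ [s]) \<longleftrightarrow> (\<exists>v' i. v = v' @ [i] \<and> compatible v' w \<and> i \<in> s)"
proof
  assume "compatible v (w @ [s])"
  then show "\<exists>v' i. v = v' @ [i] \<and> compatible v' w \<and> i \<in> s"
    by (auto simp: compatible_def list_all2_append2 list_all2_Cons2)
next
  assume "\<exists>v' i. v = v' @ [i] \<and> compatible v' w \<and> i \<in> s"
  then show "compatible v (w @ [s])"
    by (auto simp: compatible_def intro!: list_all2_appendI)
qed

lemma meander_snoc: "meander (v @ [i]) \<longleftrightarrow> meander v \<and> 0 \<le> sum_list v + i"
  by (auto simp: meander_def le_Suc_eq)

text \<open>A new step adds one condition, on the new endpoint only, so the set reached so far
  determines all later ones.\<close>

lemma reachable_snoc: "reachable (w @ [s]) = extend (reachable w) s"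
proof (intro set_eqI iffI)
  fix z assume "z \<in> reachable (w @ [s])"
  then show "z \<in> extend (reachable w) s"
    by (force simp: reachable_def extend_def compatible_snoc meander_snoc)
next
  fix z assume "z \<in> extend (reachable w) s"
  then obtain i v where *: "0 \<le> z" "i \<in> s" "z - i = sum_list v" "compatible v w" "meander v"
    by (auto simp: reachable_def extend_def)
  then show "z \<in> reachable (w @ [s])"
    unfolding reachable_def compatible_snoc
    by (intro CollectI exI[of _ "v @ [i]"]) (auto simp: meander_snoc)
qed

lemma reachable_Nil: "reachable [] = {0}"
  by (auto simp: reachable_def compatible_def meander_def)

lemma N_meander_iff: "N_meander w \<longleftrightarrow> reachable w \<noteq> {}"
  by (auto simp: N_meander_def reachable_def)

section \<open>The two families of reachable sets\<close>

definition spaced :: "nat \<Rightarrow> nat \<Rightarrow> int set" where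
  "spaced a d = {z. int a \<le> z \<and> z \<le> int a + 2 * int d \<and> even (z - int a)}"

text \<open>Width \<open>e + 1\<close> builds in the bound \<open>b - a \<ge> 1\<close> of type I;
  singletons are the sets \<open>spaced a 0\<close>.\<close>

definition interval :: "nat \<Rightarrow> nat \<Rightarrow> int set" where
  "interval a e = {int a..int a + int e + 1}"

text \<open>A point is lost only if the minimum is \<open>0\<close> and the step contains
  \<open>-1\<close>, hence the split into \<open>0\<close> and \<open>Suc a\<close>. Losing the only
  point gives the empty set.\<close>

lemma extend_spaced:
  "extend (spaced (Suc a) d) {-1} = spaced a d"
  "extend (spaced 0 0) {-1} = {}"
  "extend (spaced 0 (Suc d)) {-1} = spaced 1 d"
  "extend (spaced a d) {0} = spaced a d"
  "extend (spaced a d) {1} = spaced (Suc a) d"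
  "extend (spaced (Suc a) d) {-1, 0} = interval a (2 * d)"
  "extend (spaced 0 0) {-1, 0} = spaced 0 0"
  "extend (spaced 0 (Suc d)) {-1, 0} = interval 0 (Suc (2 * d))"
  "extend (spaced (Suc a) d) {-1, 1} = spaced a (Suc d)"
  "extend (spaced 0 d) {-1, 1} = spaced 1 d"
  "extend (spaced a d) {0, 1} = interval a (2 * d)"
  "extend (spaced (Suc a) d) {-1, 0, 1} = interval a (Suc (2 * d))"
  "extend (spaced 0 d) {-1, 0, 1} = interval 0 (2 * d)"
  unfolding set_eq_iff extend_def spaced_def interval_def
  by (simp_all; presburger)+

lemma extend_interval:
  "extend (interval (Suc a) e) {-1} = interval a e"
  "extend (interval 0 0) {-1} = spaced 0 0"
  "extend (interval 0 (Suc e)) {-1} = interval 0 e"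
  "extend (interval a e) {0} = interval a e"
  "extend (interval a e) {1} = interval (Suc a) e"
  "extend (interval (Suc a) e) {-1, 0} = interval a (Suc e)"
  "extend (interval 0 e) {-1, 0} = interval 0 e"
  "extend (interval (Suc a) e) {-1, 1} = interval a (Suc (Suc e))"
  "extend (interval 0 e) {-1, 1} = interval 0 (Suc e)"
  "extend (interval a e) {0, 1} = interval a (Suc e)"
  "extend (interval (Suc a) e) {-1, 0, 1} = interval a (Suc (Suc e))"
  "extend (interval 0 e) {-1, 0, 1} = interval 0 (Suc e)"
  unfolding set_eq_iff extend_def spaced_def interval_def
  by (simp_all; presburger)+

lemma extend_empty: "extend {} s = {}"
  by (simp add: extend_def)

text \<open>The empty set is included since sums will run over all N-walks, also those without a
  compatible meander.\<close>

inductive_set shapes :: "int set set" where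
  empty: "{} \<in> shapes"
| spaced: "spaced a d \<in> shapes"
| interval: "interval a e \<in> shapes"

lemma extend_shapes:
  assumes "R \<in> shapes" "s \<in> motzkin_N_steps"
  shows "extend R s \<in> shapes"
  using assms(1)
proof cases
  case empty
  then show ?thesis by (simp add: extend_empty shapes.empty)
next
  case (spaced a d)
  then show ?thesis using assms(2) unfolding motzkin_N_steps_def
    by (cases a; cases d) (auto simp: extend_spaced intro: shapes.intros)
next
  case (interval a e)
  then show ?thesis using assms(2) unfolding motzkin_N_steps_def
    by (cases a; cases e) (auto simp: extend_interval intro: shapes.intros)
qed

lemma spaced_0_0: "spaced 0 0 = {0}"
  by (auto simp: spaced_def)

lemma reachable_shapes: "w \<in> lists motzkin_N_steps \<Longrightarrow> reachable w \<in> shapes"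
proof (induction w rule: rev_induct)
  case Nil
  then show ?case using shapes.spaced[of 0 0] by (simp add: reachable_Nil spaced_0_0)
next
  case (snoc s w)
  then show ?case by (simp add: reachable_snoc extend_shapes)
qed

section \<open>Types of the two families\<close>

lemma Min_spaced: "Min (spaced a d) = int a" and Max_spaced: "Max (spaced a d) = int a + 2 * int d"
proof -
  have "finite (spaced a d)"
    by (rule finite_subset[of _ "{int a..int a + 2 * int d}"]) (auto simp: spaced_def)
  then show "Min (spaced a d) = int a" "Max (spaced a d) = int a + 2 * int d"
    by (auto intro!: Min_eqI Max_eqI simp: spaced_def)
qed

lemma Min_interval: "Min (interval a e) = int a"
  and Max_interval: "Max (interval a e) = int a + int e + 1"
  by (auto intro!: Min_eqI Max_eqI simp: interval_def)

lemma shapes_nonempty: "spaced a d \<noteq> {}" "interval a e \<noteq> {}"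
proof -
  have "int a \<in> spaced a d" "int a \<in> interval a e" by (auto simp: spaced_def interval_def)
  then show "spaced a d \<noteq> {}" "interval a e \<noteq> {}" by auto
qed

lemma type_II_spaced: "type_II (spaced a d)"
proof -
  have "spaced a d = {int a + 2 * i | i. 0 \<le> i \<and> i \<le> int d}"
    unfolding spaced_def set_eq_iff mem_Collect_eq by presburger
  then show ?thesis unfolding type_II_def Min_spaced Max_spaced by simp
qed

lemma type_I_interval: "type_I (interval a e)"
proof -
  have "interval a e = {int a + i | i. 0 \<le> i \<and> i \<le> int e + 1}"
    unfolding interval_def set_eq_iff mem_Collect_eq atLeastAtMost_iff by presburger
  then show ?thesis unfolding type_I_def Min_interval Max_interval by (simp add: add.assoc)
qed

lemma not_type_I_spaced: "\<not> type_I (spaced a d)"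
proof
  assume "type_I (spaced a d)"
  \<comment> \<open>The width condition excludes singletons, so \<open>int a + 1\<close> lies in the
    right-hand set although its parity is wrong.\<close>
  then have eq: "spaced a d = {int a + i | i. 0 \<le> i \<and> i \<le> 2 * int d}" and "2 * int d \<ge> 1"
    by (simp_all add: type_I_def Min_spaced Max_spaced)
  then have "int a + 1 \<in> spaced a d" by simp
  then show False by (simp add: spaced_def)
qed

lemma not_type_II_interval: "\<not> type_II (interval a e)"
proof
  assume "type_II (interval a e)"
  then have eq: "interval a e = {int a + 2 * i | i. 0 \<le> i \<and> i \<le> (int e + 1) div 2}"
    by (simp add: type_II_def Min_interval Max_interval)
  have "int a + 1 \<in> interval a e" by (simp add: interval_def)
  then show False unfolding eq by simp presburger
qed

text \<open>\<open>u\<close> marks the minimum and \<open>y\<close> the width. Since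
  \<open>0 ^ 0 = 1\<close>, putting \<open>u = 0\<close> selects minimum \<open>0\<close>; on
  \<open>shapes\<close>, \<open>weight_II 0 0\<close> and \<open>weight_I 0 0\<close> are the
  indicators of \<open>{0}\<close> and \<open>{0, 1}\<close>.\<close>

definition weight_II :: "'c::comm_ring_1 \<Rightarrow> 'c \<Rightarrow> int set \<Rightarrow> 'c" where
  "weight_II u y R =
    (if R \<noteq> {} \<and> type_II R then u ^ nat (Min R) * y ^ nat (Max R - Min R) else 0)"

definition weight_I :: "'c::comm_ring_1 \<Rightarrow> 'c \<Rightarrow> int set \<Rightarrow> 'c" where
  "weight_I u y R =
    (if R \<noteq> {} \<and> type_I R then u ^ nat (Min R) * y ^ nat (Max R - Min R - 1) else 0)"

lemma weight_simps:
  "weight_II u y {} = 0" "weight_I u y {} = 0"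
  "weight_II u y (spaced a d) = u ^ a * y ^ (2 * d)" "weight_I u y (spaced a d) = 0"
  "weight_II u y (interval a e) = 0" "weight_I u y (interval a e) = u ^ a * y ^ e"
  by (simp_all add: weight_I_def weight_II_def type_II_spaced not_type_I_spaced type_I_interval
      not_type_II_interval shapes_nonempty Min_spaced Max_spaced Min_interval Max_interval nat_mult_distrib)

section \<open>The effect of one step on the weights\<close>

definition transfer :: "(int set \<Rightarrow> 'c::comm_ring_1) \<Rightarrow> int set \<Rightarrow> 'c" where
  "transfer f R = (\<Sum>s\<in>motzkin_N_steps. f (extend R s))"

lemma sum_motzkin_N_steps:
  "(\<Sum>s\<in>motzkin_N_steps. f s) =
    f {-1} + f {0} + f {1} + f {-1, 0} + f {-1, 1} + f {0, 1} + f {-1, 0, 1}"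
proof -
  have "{-1, 0} \<notin> {{-1, 1}, {0, 1}, {-1, 0, 1::int}}" "{-1, 1} \<notin> {{0, 1}, {-1, 0, 1::int}}"
    "{0, 1} \<notin> {{-1, 0, 1::int}}"
    by (simp_all add: set_eq_iff; presburger)+
  then have "sum f {{-1, 0}, {-1, 1}, {0, 1}, {-1, 0, 1}} =
      f {-1, 0} + (f {-1, 1} + (f {0, 1} + f {-1, 0, 1}))"
    by (simp only: sum.insert finite.intros sum.empty add_0_right empty_iff not_False_eq_True)
  then show ?thesis
    unfolding motzkin_N_steps_def by (simp add: add.assoc)
qed

text \<open>The factor \<open>u * y\<^sup>2\<close> clears inverses. Losing the point
  \<open>-1\<close> from a type II set raises the minimum by 2 and lowers the width by 2, whence
  \<open>u\<^sup>2 - y\<^sup>2\<close>. The other terms treat \<open>{0}\<close>, which dies under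
  \<open>{-1}\<close> and stays under \<open>{-1, 0}\<close>, and \<open>{0, 1}\<close>, which
  \<open>{-1}\<close> turns into \<open>{0}\<close>.\<close>

lemma transfer_weight_II:
  assumes "R \<in> shapes"
  shows "u * y\<^sup>2 * transfer (weight_II u y) R =
    (u + u\<^sup>2 + 1 + y\<^sup>2) * y\<^sup>2 * weight_II u y R + (1 + y\<^sup>2) * (u\<^sup>2 - y\<^sup>2) * weight_II 0 y R
    - u\<^sup>2 * weight_II 0 0 R + u * y\<^sup>2 * (weight_II 0 0 R + weight_I 0 0 R)"
  using assms
proof cases
  case empty
  then show ?thesis by (simp add: transfer_def extend_empty weight_simps)
next
  case (spaced a d)
  then show ?thesis unfolding transfer_def sum_motzkin_N_steps
    by (cases a; cases d)
      (simp_all add: extend_spaced weight_simps algebra_simps power2_eq_square)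
next
  case (interval a e)
  then show ?thesis unfolding transfer_def sum_motzkin_N_steps
    by (cases a; cases e)
      (simp_all add: extend_interval weight_simps algebra_simps power2_eq_square)
qed

text \<open>Losing the point \<open>-1\<close> from an interval raises the minimum by 1 and lowers
  the width by 1, whence \<open>u - y\<close>. The subtracted terms correct the cases where only
  \<open>{0}\<close> is left, which is of type II.\<close>

lemma transfer_weight_I:
  assumes "R \<in> shapes"
  shows "u * y * transfer (weight_I u y) R =
    (u + u\<^sup>2 + u * y + 1 + y + 2 * y\<^sup>2) * y * weight_I u y R
    + (u - y) * (1 + y + 2 * y\<^sup>2) * weight_I 0 y R - u * weight_I 0 0 R
    + (y * u + y + y\<^sup>2) * weight_II u y R + (u - y) * (1 + y) * weight_II 0 y R
    - u * weight_II 0 0 R"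
  using assms
proof cases
  case empty
  then show ?thesis by (simp add: transfer_def extend_empty weight_simps)
next
  case (spaced a d)
  then show ?thesis unfolding transfer_def sum_motzkin_N_steps
    by (cases a; cases d)
      (simp_all add: extend_spaced weight_simps algebra_simps power2_eq_square)
next
  case (interval a e)
  then show ?thesis unfolding transfer_def sum_motzkin_N_steps
    by (cases a; cases e)
      (simp_all add: extend_interval weight_simps algebra_simps power2_eq_square)
qed

section \<open>Functional equations\<close>

definition walks :: "nat \<Rightarrow> N_walk set" where
  "walks n = {w \<in> lists motzkin_N_steps. length w = n}"

definition walk_sum :: "(int set \<Rightarrow> 'c::comm_ring_1) \<Rightarrow> nat \<Rightarrow> 'c" where
  "walk_sum f n = (\<Sum>w\<in>walks n. f (reachable w))"

lemma finite_motzkin_N_steps: "finite motzkin_N_steps"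
  by (simp add: motzkin_N_steps_def)

lemma finite_walks: "finite (walks n)"
  using finite_lists_length_eq[OF finite_motzkin_N_steps, of n]
  by (simp add: walks_def lists_eq_set)

lemma walk_sum_0: "walk_sum f 0 = f {0}"
proof -
  have "walks 0 = {[]}" by (auto simp: walks_def)
  then show ?thesis by (simp add: walk_sum_def reachable_Nil)
qed

lemma walk_sum_Suc: "walk_sum f (Suc n) = walk_sum (transfer f) n"
proof -
  let ?snoc = "\<lambda>(w, s). w @ [s]"
  have "walks (Suc n) = ?snoc ` (walks n \<times> motzkin_N_steps)"
  proof (intro equalityI subsetI)
    fix w assume "w \<in> walks (Suc n)"
    then show "w \<in> ?snoc ` (walks n \<times> motzkin_N_steps)"
      by (cases w rule: rev_cases) (auto simp: walks_def image_iff)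
  qed (auto simp: walks_def)
  moreover have "inj_on ?snoc (walks n \<times> motzkin_N_steps)"
    by (auto simp: inj_on_def)
  ultimately have "walk_sum f (Suc n) =
      (\<Sum>(w, s)\<in>walks n \<times> motzkin_N_steps. f (extend (reachable w) s))"
    by (simp add: walk_sum_def sum.reindex reachable_snoc case_prod_unfold)
  then show ?thesis
    by (simp add: walk_sum_def transfer_def sum.cartesian_product)
qed

text \<open>The weights may themselves be power series in \<open>t\<close>. Substituting a root of a kernel for a
  catalytic variable is then just the choice of another weight.\<close>

definition gf :: "(int set \<Rightarrow> 'c::comm_ring_1 fps) \<Rightarrow> 'c fps" where
  "gf f = Abs_fps (\<lambda>n. \<Sum>k\<le>n. walk_sum f k $ (n - k))"

text \<open>Replaces a formally infinite sum by a finite one, exact up to degree \<open>N\<close>,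
  so that ring arithmetic applies.\<close>

lemma gf_truncate:
  assumes "n \<le> N"
  shows "gf f $ n = (\<Sum>k\<le>N. fps_X ^ k * walk_sum f k) $ n"
proof -
  have "(\<Sum>k\<le>N. fps_X ^ k * walk_sum f k) $ n = (\<Sum>k\<le>N. if n < k then 0 else walk_sum f k $ (n - k))"
    by (simp add: fps_sum_nth fps_X_power_mult_nth)
  also have "\<dots> = (\<Sum>k\<le>n. walk_sum f k $ (n - k))"
    using assms by (intro sum.mono_neutral_cong_right) auto
  finally show ?thesis by (simp add: gf_def)
qed

lemma gf_add: "gf (\<lambda>R. f R + g R) = gf f + gf g"
  by (rule fps_ext) (simp add: gf_def walk_sum_def sum.distrib)

lemma gf_diff: "gf (\<lambda>R. f R - g R) = gf f - gf g"
  by (rule fps_ext) (simp add: gf_def walk_sum_def sum_subtractf)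

text \<open>As \<open>c\<close> may be a power series, all lower coefficients enter; one truncation
  at degree \<open>n\<close> serves them all.\<close>

lemma gf_mult: "gf (\<lambda>R. c * f R) = c * gf f"
proof (rule fps_ext)
  fix n
  have "walk_sum (\<lambda>R. c * f R) k = c * walk_sum f k" for k
    by (simp add: walk_sum_def sum_distrib_left)
  then have "gf (\<lambda>R. c * f R) $ n = (c * (\<Sum>k\<le>n. fps_X ^ k * walk_sum f k)) $ n"
    by (simp add: gf_truncate[OF order_refl] sum_distrib_left mult.left_commute)
  also have "\<dots> = (\<Sum>i=0..n. c $ i * gf f $ (n - i))"
    unfolding fps_mult_nth by (intro sum.cong refl) (simp add: gf_truncate[of _ n])
  finally show "gf (\<lambda>R. c * f R) $ n = (c * gf f) $ n" by (simp add: fps_mult_nth)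
qed

lemma gf_cong:
  assumes "\<And>R. R \<in> shapes \<Longrightarrow> f R = g R"
  shows "gf f = gf g"
proof -
  have "walk_sum f = walk_sum g"
    by (intro ext, unfold walk_sum_def, intro sum.cong)
      (auto simp: walks_def intro!: assms reachable_shapes)
  then show ?thesis by (simp add: gf_def)
qed

lemma gf_rec: "gf f = f {0} + fps_X * gf (transfer f)"
proof (rule fps_ext)
  fix n
  show "gf f $ n = (f {0} + fps_X * gf (transfer f)) $ n"
  proof (cases n)
    case 0
    then show ?thesis by (simp add: gf_def walk_sum_0)
  next
    case (Suc m)
    then show ?thesis
      by (simp add: gf_def sum.atMost_Suc_shift walk_sum_0 walk_sum_Suc del: sum.atMost_Suc)
  qed
qed

abbreviation gf_I :: "'c::comm_ring_1 fps \<Rightarrow> 'c fps \<Rightarrow> 'c fps" where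
  "gf_I u y \<equiv> gf (weight_I u y)"

abbreviation gf_II :: "'c::comm_ring_1 fps \<Rightarrow> 'c fps \<Rightarrow> 'c fps" where
  "gf_II u y \<equiv> gf (weight_II u y)"

lemma gf_II_eq:
  "u * y\<^sup>2 * gf_II u y = u * y\<^sup>2 + fps_X * (
    (u + u\<^sup>2 + 1 + y\<^sup>2) * y\<^sup>2 * gf_II u y + (1 + y\<^sup>2) * (u\<^sup>2 - y\<^sup>2) * gf_II 0 y
    - u\<^sup>2 * gf_II 0 0 + u * y\<^sup>2 * (gf_II 0 0 + gf_I 0 0))"
proof -
  have "u * y\<^sup>2 * gf_II u y = u * y\<^sup>2 * weight_II u y {0}
      + fps_X * gf (\<lambda>R. u * y\<^sup>2 * transfer (weight_II u y) R)"
    unfolding gf_mult by (subst gf_rec) (simp add: algebra_simps)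
  also have "gf (\<lambda>R. u * y\<^sup>2 * transfer (weight_II u y) R) =
      (u + u\<^sup>2 + 1 + y\<^sup>2) * y\<^sup>2 * gf_II u y + (1 + y\<^sup>2) * (u\<^sup>2 - y\<^sup>2) * gf_II 0 y
    - u\<^sup>2 * gf_II 0 0 + u * y\<^sup>2 * (gf_II 0 0 + gf_I 0 0)"
    by (subst gf_cong[OF transfer_weight_II]) (simp_all only: gf_add gf_diff gf_mult)
  finally show ?thesis
    using weight_simps(3)[of u y 0 0] by (simp add: spaced_0_0)
qed

lemma gf_I_eq:
  "u * y * gf_I u y = fps_X * (
    (u + u\<^sup>2 + u * y + 1 + y + 2 * y\<^sup>2) * y * gf_I u y
    + (u - y) * (1 + y + 2 * y\<^sup>2) * gf_I 0 y - u * gf_I 0 0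
    + (y * u + y + y\<^sup>2) * gf_II u y + (u - y) * (1 + y) * gf_II 0 y - u * gf_II 0 0)"
proof -
  have "u * y * gf_I u y = u * y * weight_I u y {0}
      + fps_X * gf (\<lambda>R. u * y * transfer (weight_I u y) R)"
    unfolding gf_mult by (subst gf_rec) (simp add: algebra_simps)
  also have "gf (\<lambda>R. u * y * transfer (weight_I u y) R) =
      (u + u\<^sup>2 + u * y + 1 + y + 2 * y\<^sup>2) * y * gf_I u y
    + (u - y) * (1 + y + 2 * y\<^sup>2) * gf_I 0 y - u * gf_I 0 0
    + (y * u + y + y\<^sup>2) * gf_II u y + (u - y) * (1 + y) * gf_II 0 y - u * gf_II 0 0"
    by (subst gf_cong[OF transfer_weight_I]) (simp_all only: gf_add gf_diff gf_mult)
  finally show ?thesis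
    using weight_simps(4)[of u y 0 0] by (simp add: spaced_0_0)
qed

section \<open>The kernel method\<close>

text \<open>Coefficients of the solution of \<open>F = t (a + b F + c F\<^sup>2)\<close> with zero
  constant term: each depends only on earlier ones.\<close>

fun quadratic_coeff :: "'c::comm_ring_1 \<Rightarrow> 'c \<Rightarrow> 'c \<Rightarrow> nat \<Rightarrow> 'c" where
  "quadratic_coeff a b c 0 = 0"
| "quadratic_coeff a b c (Suc n) = (if n = 0 then a else 0) + b * quadratic_coeff a b c n
    + c * (\<Sum>i=0..n. quadratic_coeff a b c i * quadratic_coeff a b c (n - i))"

lemma ex_quadratic_root:
  fixes a b c :: "'c::idom"
  obtains F where "F = fps_X * (fps_const a + fps_const b * F + fps_const c * F\<^sup>2)"
    "F $ 0 = 0" "algebraic_fps F"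
proof -
  define F where "F = Abs_fps (quadratic_coeff a b c)"
  have eq: "F = fps_X * (fps_const a + fps_const b * F + fps_const c * F\<^sup>2)"
  proof (rule fps_ext)
    fix n
    show "F $ n = (fps_X * (fps_const a + fps_const b * F + fps_const c * F\<^sup>2)) $ n"
      by (cases n) (simp_all add: F_def power2_eq_square fps_mult_nth[of "Abs_fps _" "Abs_fps _"])
  qed
  \<comment> \<open>The polynomial \<open>c t F\<^sup>2 + (b t - 1) F + a t\<close> in
    \<open>F\<close>; the \<open>-1\<close> keeps it nonzero for all \<open>a\<close>,
    \<open>b\<close>, \<open>c\<close>.\<close>
  define P where "P = [:monom a 1, monom b 1 - 1, monom c 1:]"
  have "coeff (coeff P 1) 0 \<noteq> 0" by (simp add: P_def)
  then have "P \<noteq> 0" by (intro notI) simp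
  moreover have "poly (map_poly fps_of_poly P) F =
      fps_X * (fps_const a + fps_const b * F + fps_const c * F\<^sup>2) - F"
    by (simp add: P_def map_poly_pCons fps_of_poly_diff fps_of_poly_monom algebra_simps power2_eq_square)
  ultimately have "algebraic_fps F"
    using eq unfolding algebraic_fps_def by (metis right_minus_eq)
  then show ?thesis using that eq by (simp add: F_def)
qed

lemma algebraic_fps_power: "algebraic_fps F \<Longrightarrow> algebraic_fps (F ^ n)"
  by (induction n) (use algebraic_fps_const[of 1] in \<open>simp_all add: fps.alg_mult\<close>)

lemma algebraic_fps_numeral: "algebraic_fps (numeral k)" "algebraic_fps 1"
  using algebraic_fps_const[of "numeral k"] algebraic_fps_const[of 1]
  by (simp_all add: numeral_fps_const)

lemmas algebraic_intros =
  fps.alg_add fps.alg_mult fps.alg_diff algebraic_fps_X algebraic_fps_numeral algebraic_fps_power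

text \<open>At \<open>u = y\<close> the factors \<open>u - y\<close> and
  \<open>u\<^sup>2 - y\<^sup>2\<close> remove the series \<open>gf_I 0 y\<close> and
  \<open>gf_II 0 y\<close>, and the type I kernel becomes
  \<open>u - t (1 + 2 u + 4 u\<^sup>2)\<close>, with root \<open>Y\<close>.\<close>

lemma algebraic_gf_II_0_0: "algebraic_fps (gf_II 0 0 :: 'c::idom fps)"
proof -
  obtain Y :: "'c fps" where Y: "Y = fps_X * (1 + 2 * Y + 4 * Y\<^sup>2)" "algebraic_fps Y"
    using ex_quadratic_root[of 1 2 4] by (auto simp: numeral_fps_const)
  then have "Y \<noteq> 0" by auto
  let ?A = "gf_II Y Y" let ?P = "gf_II 0 0 :: 'c fps" let ?Q = "gf_I 0 0 :: 'c fps"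
  have "Y * fps_X * ((1 + 2 * Y) * ?A) = Y * fps_X * (?P + ?Q)"
    using gf_I_eq[of Y Y] Y(1) by algebra
  then have "(1 + 2 * Y) * ?A = ?P + ?Q" using \<open>Y \<noteq> 0\<close> by simp
  note PQ = this[symmetric]
  have "Y\<^sup>2 * (fps_X * ?P) = Y * Y\<^sup>2
      + fps_X * ((Y + Y\<^sup>2 + 1 + Y\<^sup>2) * Y\<^sup>2 * ?A + Y * Y\<^sup>2 * (?P + ?Q)) - Y * Y\<^sup>2 * ?A"
    using gf_II_eq[of Y Y] by (simp add: algebra_simps)
  \<comment> \<open>Eliminating \<open>?P + ?Q\<close> recreates
    \<open>1 + 2 * Y + 4 * Y\<^sup>2\<close>, so the two terms in \<open>?A\<close> cancel.\<close>
  also have "\<dots> = Y\<^sup>2 * Y + Y\<^sup>2 * ?A * (fps_X * (1 + 2 * Y + 4 * Y\<^sup>2)) - Y\<^sup>2 * ?A * Y"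
    unfolding PQ by (simp add: algebra_simps power2_eq_square)
  also have "fps_X * (1 + 2 * Y + 4 * Y\<^sup>2) = Y" by (rule Y(1)[symmetric])
  finally have "Y\<^sup>2 * (fps_X * ?P) = Y\<^sup>2 * Y" by simp
  then have "fps_X * ?P = Y" using \<open>Y \<noteq> 0\<close> by simp
  then show ?thesis
    by (rule fps.alg_quotient) (simp_all add: Y(2) algebraic_fps_X)
qed

text \<open>Again \<open>u = y\<close>, now at the root \<open>W\<close> of the type II kernel; the
  type II equation alone then links \<open>gf_I 0 0\<close> to \<open>gf_II 0 0\<close>.\<close>

lemma algebraic_gf_I_0_0: "algebraic_fps (gf_I 0 0 :: 'c::idom fps)"
proof -
  obtain W :: "'c fps" where W: "W = fps_X * (1 + W + 2 * W\<^sup>2)" "algebraic_fps W"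
    using ex_quadratic_root[of 1 1 2] by (auto simp: numeral_fps_const)
  then have "W \<noteq> 0" by auto
  let ?P = "gf_II 0 0 :: 'c fps" let ?Q = "gf_I 0 0 :: 'c fps"
  have "W\<^sup>2 * (fps_X * W * ?Q) = W\<^sup>2 * (fps_X * ?P - W - fps_X * W * ?P)"
    using gf_II_eq[of W W] W(1) by algebra
  then have "fps_X * W * ?Q = fps_X * ?P - W - fps_X * W * ?P" using \<open>W \<noteq> 0\<close> by simp
  then show ?thesis
    by (rule fps.alg_quotient) (use \<open>W \<noteq> 0\<close> in \<open>simp_all add: W(2) algebraic_intros algebraic_gf_II_0_0\<close>)
qed

text \<open>With \<open>y\<close> kept as a parameter, \<open>u = U\<close> annihilates the type II
  kernel and leaves \<open>gf_II 0 y\<close> as the only unknown.\<close>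

lemma algebraic_gf_II_0:
  fixes b :: "'c::idom"
  defines "y \<equiv> fps_const b"
  assumes b: "b \<noteq> 0" "1 + b\<^sup>2 \<noteq> 0"
  shows "algebraic_fps (gf_II 0 y)"
proof -
  obtain U :: "'c fps" where U: "U = fps_X * (1 + y\<^sup>2 + U + U\<^sup>2)" "U $ 0 = 0" "algebraic_fps U"
    using ex_quadratic_root[of "1 + b\<^sup>2" 1 1]
    by (auto simp: y_def fps_const_power fps_const_add[symmetric] simp del: fps_const_add)
  let ?P = "gf_II 0 0 :: 'c fps" let ?Q = "gf_I 0 0 :: 'c fps"
  have eq: "fps_X * (1 + y\<^sup>2) * (y\<^sup>2 - U\<^sup>2) * gf_II 0 y =
      U * y\<^sup>2 - fps_X * U\<^sup>2 * ?P + fps_X * U * y\<^sup>2 * (?P + ?Q)"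
    using gf_II_eq[of U y] U(1) by algebra
  \<comment> \<open>The constant terms in \<open>t\<close> are \<open>1 + b\<^sup>2\<close> and
    \<open>b\<^sup>2\<close>, as \<open>U\<close> has none.\<close>
  have "(1 + y\<^sup>2) $ 0 \<noteq> 0" "(y\<^sup>2 - U\<^sup>2) $ 0 \<noteq> 0"
    using b U(2) by (simp_all add: y_def fps_const_power fps_power_zeroth)
  then have "1 + y\<^sup>2 \<noteq> 0" "y\<^sup>2 - U\<^sup>2 \<noteq> 0" by (metis fps_zero_nth)+
  then have "fps_X * (1 + y\<^sup>2) * (y\<^sup>2 - U\<^sup>2) \<noteq> 0" by simp
  moreover have "algebraic_fps y" by (simp add: y_def algebraic_fps_const)
  ultimately show ?thesis
    by (intro fps.alg_quotient[OF eq] algebraic_intros algebraic_gf_II_0_0 algebraic_gf_I_0_0 U(3))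
qed

text \<open>Off the kernel root the equation is solved for \<open>gf_II u y\<close>. Besides
  constants, \<open>u\<close> will be the root \<open>Z\<close> of the other kernel.\<close>

lemma algebraic_gf_II:
  fixes b :: "'c::idom"
  defines "y \<equiv> fps_const b"
  assumes b: "b \<noteq> 0" "1 + b\<^sup>2 \<noteq> 0"
    and u: "algebraic_fps u" "u - fps_X * (u + u\<^sup>2 + 1 + y\<^sup>2) \<noteq> 0"
  shows "algebraic_fps (gf_II u y)"
proof -
  let ?P = "gf_II 0 0 :: 'c fps" let ?Q = "gf_I 0 0 :: 'c fps"
  have eq: "y\<^sup>2 * (u - fps_X * (u + u\<^sup>2 + 1 + y\<^sup>2)) * gf_II u y =
      u * y\<^sup>2 + fps_X * ((1 + y\<^sup>2) * (u\<^sup>2 - y\<^sup>2) * gf_II 0 y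
      - u\<^sup>2 * ?P + u * y\<^sup>2 * (?P + ?Q))"
    using gf_II_eq[of u y] by algebra
  have "y\<^sup>2 * (u - fps_X * (u + u\<^sup>2 + 1 + y\<^sup>2)) \<noteq> 0" using b u by (simp add: y_def)
  moreover have "algebraic_fps y" by (simp add: y_def algebraic_fps_const)
  moreover have "algebraic_fps (gf_II 0 y)" unfolding y_def using b by (rule algebraic_gf_II_0)
  ultimately show ?thesis
    by (intro fps.alg_quotient[OF eq] algebraic_intros algebraic_gf_II_0_0 algebraic_gf_I_0_0 u)
qed

text \<open>Setting \<open>u = Z\<close> annihilates the type I kernel and expresses
  \<open>gf_I 0 y\<close> through series known to be algebraic, among them
  \<open>gf_II Z y\<close>.\<close>

lemma algebraic_gf_I_0:
  fixes b :: "'c::idom"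
  defines "y \<equiv> fps_const b"
  assumes b: "b \<noteq> 0" "1 + b\<^sup>2 \<noteq> 0" "1 + b \<noteq> 0" "1 + b + 2 * b\<^sup>2 \<noteq> 0"
  shows "algebraic_fps (gf_I 0 y)"
proof -
  obtain Z :: "'c fps" where Z: "Z = fps_X * (1 + y + 2 * y\<^sup>2 + (1 + y) * Z + Z\<^sup>2)"
    "Z $ 0 = 0" "algebraic_fps Z"
    using ex_quadratic_root[of "1 + b + 2 * b\<^sup>2" "1 + b" 1]
    by (auto simp: y_def fps_const_power fps_const_add[symmetric] fps_const_mult[symmetric]
        numeral_fps_const simp del: fps_const_add fps_const_mult)
  let ?P = "gf_II 0 0 :: 'c fps" let ?Q = "gf_I 0 0 :: 'c fps"
  have y: "algebraic_fps y" by (simp add: y_def algebraic_fps_const)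
  have "fps_X * ((y - Z) * (1 + y + 2 * y\<^sup>2) * gf_I 0 y) =
      fps_X * ((y * Z + y + y\<^sup>2) * gf_II Z y + (Z - y) * (1 + y) * gf_II 0 y - Z * ?P - Z * ?Q)"
    using gf_I_eq[of Z y] Z(1) by algebra
  then have eq: "(y - Z) * (1 + y + 2 * y\<^sup>2) * gf_I 0 y =
      (y * Z + y + y\<^sup>2) * gf_II Z y + (Z - y) * (1 + y) * gf_II 0 y - Z * ?P - Z * ?Q"
    by simp
  have "(y - Z) $ 0 \<noteq> 0" "(1 + y + 2 * y\<^sup>2) $ 0 \<noteq> 0" "(Z + 1 + y) $ 0 \<noteq> 0"
    using b Z(2) by (simp_all add: y_def fps_const_power numeral_fps_const)
  then have nz: "y - Z \<noteq> 0" "1 + y + 2 * y\<^sup>2 \<noteq> 0" "Z + 1 + y \<noteq> 0" by (metis fps_zero_nth)+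
  \<comment> \<open>The two kernels differ by \<open>t y (u + 1 + y)\<close>, so the type II kernel
    does not vanish at the root \<open>Z\<close> of the type I kernel.\<close>
  have "Z - fps_X * (Z + Z\<^sup>2 + 1 + y\<^sup>2) = fps_X * y * (Z + 1 + y)"
    using Z(1) by algebra
  moreover have "y \<noteq> 0" using b by (simp add: y_def)
  ultimately have "Z - fps_X * (Z + Z\<^sup>2 + 1 + y\<^sup>2) \<noteq> 0" using nz by simp
  then have "algebraic_fps (gf_II Z y)" "algebraic_fps (gf_II 0 y)"
    unfolding y_def using b Z(3) by (auto intro: algebraic_gf_II algebraic_gf_II_0)
  moreover have "(y - Z) * (1 + y + 2 * y\<^sup>2) \<noteq> 0" using nz by simp
  ultimately show ?thesis
    by (intro fps.alg_quotient[OF eq] algebraic_intros algebraic_gf_II_0_0 algebraic_gf_I_0_0 Z y)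
qed

lemma algebraic_gf_I:
  fixes b :: "'c::idom"
  defines "y \<equiv> fps_const b"
  assumes b: "b \<noteq> 0" "1 + b\<^sup>2 \<noteq> 0" "1 + b \<noteq> 0" "1 + b + 2 * b\<^sup>2 \<noteq> 0" and "a \<noteq> 0"
  shows "algebraic_fps (gf_I (fps_const a) y)" "algebraic_fps (gf_II (fps_const a) y)"
proof -
  let ?P = "gf_II 0 0 :: 'c fps" let ?Q = "gf_I 0 0 :: 'c fps"
  define u where "u = fps_const a"
  have u: "algebraic_fps u" and y: "algebraic_fps y" by (simp_all add: u_def y_def algebraic_fps_const)
  \<comment> \<open>At \<open>t = 0\<close> these expressions reduce to \<open>a\<close> and
    \<open>b * a\<close>.\<close>
  have "(u - fps_X * (u + u\<^sup>2 + 1 + y\<^sup>2)) $ 0 \<noteq> 0"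
    "(y * (u - fps_X * (u + u\<^sup>2 + u * y + 1 + y + 2 * y\<^sup>2))) $ 0 \<noteq> 0"
    using \<open>a \<noteq> 0\<close> b by (simp_all add: u_def y_def)
  then have nz: "u - fps_X * (u + u\<^sup>2 + 1 + y\<^sup>2) \<noteq> 0"
    "y * (u - fps_X * (u + u\<^sup>2 + u * y + 1 + y + 2 * y\<^sup>2)) \<noteq> 0" by (metis fps_zero_nth)+
  show A: "algebraic_fps (gf_II (fps_const a) y)"
    using nz(1) u b unfolding y_def u_def by (intro algebraic_gf_II) auto
  have eq: "y * (u - fps_X * (u + u\<^sup>2 + u * y + 1 + y + 2 * y\<^sup>2)) * gf_I u y = fps_X * (
      (u - y) * (1 + y + 2 * y\<^sup>2) * gf_I 0 y - u * ?Q
      + (y * u + y + y\<^sup>2) * gf_II u y + (u - y) * (1 + y) * gf_II 0 y - u * ?P)"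
    using gf_I_eq[of u y] by algebra
  have "algebraic_fps (gf_I 0 y)" "algebraic_fps (gf_II 0 y)"
    unfolding y_def using b by (auto intro: algebraic_gf_I_0 algebraic_gf_II_0)
  then show "algebraic_fps (gf_I (fps_const a) y)"
    unfolding u_def[symmetric] using A[folded u_def] nz(2)
    by (intro fps.alg_quotient[OF eq] algebraic_intros algebraic_gf_II_0_0 algebraic_gf_I_0_0 u y)
qed

section \<open>The generating functions in \<open>x\<close> and \<open>y\<close>\<close>

definition endpoint_monom :: "int set \<Rightarrow> rat poly poly" where
  "endpoint_monom R = monom (monom 1 (nat (Max R))) (nat (Min R))"

lemma walk_gf_eq_walk_sum:
  assumes "A = {w \<in> lists motzkin_N_steps. P (reachable w)}"
  shows "walk_gf A = Abs_fps (walk_sum (\<lambda>R. if P R then endpoint_monom R else 0))"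
proof (rule fps_ext)
  fix n
  have "{w \<in> A. length w = n} = {w \<in> walks n. P (reachable w)}"
    using assms by (auto simp: walks_def)
  then show "walk_gf A $ n = Abs_fps (walk_sum (\<lambda>R. if P R then endpoint_monom R else 0)) $ n"
    by (simp add: walk_gf_def walk_sum_def endpoint_monom_def min_plus_def max_plus_def
        sum.inter_filter[symmetric] finite_walks)
qed

text \<open>For weights free of \<open>t\<close>, only walks of length exactly \<open>n\<close>
  contribute to coefficient \<open>n\<close>.\<close>

lemma gf_fps_const: "gf (\<lambda>R. fps_const (f R)) = Abs_fps (walk_sum f)"
proof (rule fps_ext)
  fix n
  have const: "walk_sum (\<lambda>R. fps_const (f R)) k = fps_const (walk_sum f k)" for k
    by (rule fps_ext) (simp add: walk_sum_def fps_sum_nth)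
  have "gf (\<lambda>R. fps_const (f R)) $ n = (\<Sum>k\<le>n. if k = n then walk_sum f n else 0)"
    unfolding gf_def const by (auto intro!: sum.cong)
  then show "gf (\<lambda>R. fps_const (f R)) $ n = Abs_fps (walk_sum f) $ n" by simp
qed

lemma weight_fps_const:
  "weight_I (fps_const a) (fps_const b) R = fps_const (weight_I a b R)"
  "weight_II (fps_const a) (fps_const b) R = fps_const (weight_II a b R)"
  by (simp_all add: weight_I_def weight_II_def fps_const_power)

lemma gf_eq_walk_sum:
  assumes "\<And>R. R \<in> shapes \<Longrightarrow> f R = c * g R"
  shows "Abs_fps (walk_sum f) = fps_const c * gf (\<lambda>R. fps_const (g R))"
  unfolding gf_mult[symmetric] gf_fps_const[symmetric]
  by (rule gf_cong) (simp add: assms)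

lemma monom_monom_power: "monom (monom (1::rat) i) j ^ n = monom (monom 1 (i * n)) (j * n)"
  by (simp add: monom_power)

text \<open>\<open>xy\<close> is the product of both variables, \<open>y\<close> the inner one, and
  \<open>y'\<close> the same variable after \<open>x = 0\<close>. The monomial of a walk is
  \<open>xy\<close> to the minimum times \<open>y\<close> to the width.\<close>

context
  fixes xy y :: "rat poly poly" and y' :: "rat poly"
  defines "xy \<equiv> monom (monom 1 1) 1" and "y \<equiv> monom (monom 1 1) 0" and "y' \<equiv> monom 1 1"
begin

text \<open>The factor \<open>fps_const y\<close> restores the unit by which \<open>weight_I\<close>
  lowers the width.\<close>

lemma M_plus_I_eq: "M_plus_I = fps_const y * gf_I (fps_const xy) (fps_const y)"
proof -
  have "M_plus_I = Abs_fps (walk_sum (\<lambda>R. if R \<noteq> {} \<and> type_I R then endpoint_monom R else 0))"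
    unfolding M_plus_I_def
    by (rule walk_gf_eq_walk_sum)
      (auto simp: motzkin_N_meanders_I_def motzkin_N_meanders_def N_meander_iff)
  also have "\<dots> = fps_const y * gf (\<lambda>R. fps_const (weight_I xy y R))"
  proof (rule gf_eq_walk_sum)
    fix R assume "R \<in> shapes"
    then show "(if R \<noteq> {} \<and> type_I R then endpoint_monom R else 0) = y * weight_I xy y R"
      by cases (simp_all add: weight_simps not_type_I_spaced type_I_interval shapes_nonempty
          endpoint_monom_def Min_interval Max_interval xy_def y_def monom_monom_power mult_monom
          nat_add_distrib)
  qed
  finally show ?thesis by (simp add: weight_fps_const[abs_def])
qed

lemma M_plus_II_eq: "M_plus_II = gf_II (fps_const xy) (fps_const y)"
proof -
  have "M_plus_II = Abs_fps (walk_sum (\<lambda>R. if R \<noteq> {} \<and> type_II R then endpoint_monom R else 0))"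
    unfolding M_plus_II_def
    by (rule walk_gf_eq_walk_sum)
      (auto simp: motzkin_N_meanders_II_def motzkin_N_meanders_def N_meander_iff)
  also have "\<dots> = fps_const 1 * gf (\<lambda>R. fps_const (weight_II xy y R))"
  proof (rule gf_eq_walk_sum)
    fix R assume "R \<in> shapes"
    then show "(if R \<noteq> {} \<and> type_II R then endpoint_monom R else 0) = 1 * weight_II xy y R"
      by cases (simp_all add: weight_simps not_type_II_interval type_II_spaced shapes_nonempty
          endpoint_monom_def Min_spaced Max_spaced xy_def y_def monom_monom_power mult_monom
          nat_add_distrib nat_mult_distrib)
  qed
  finally show ?thesis by (simp add: weight_fps_const[abs_def])
qed

text \<open>Every nonempty shape is of exactly one type, so exactly one of the two weights
  survives.\<close>

lemma M_plus_eq: "M_plus = M_plus_I + M_plus_II"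
proof -
  have "M_plus = Abs_fps (walk_sum (\<lambda>R. if R \<noteq> {} then endpoint_monom R else 0))"
    unfolding M_plus_def
    by (rule walk_gf_eq_walk_sum) (auto simp: motzkin_N_meanders_def N_meander_iff)
  also have "\<dots> = fps_const 1 * gf (\<lambda>R. fps_const (y * weight_I xy y R + weight_II xy y R))"
  proof (rule gf_eq_walk_sum)
    fix R assume "R \<in> shapes"
    then show "(if R \<noteq> {} then endpoint_monom R else 0) = 1 * (y * weight_I xy y R + weight_II xy y R)"
      by cases (simp_all add: weight_simps shapes_nonempty endpoint_monom_def Min_spaced Max_spaced
          Min_interval Max_interval xy_def y_def monom_monom_power mult_monom
          nat_add_distrib nat_mult_distrib)
  qed
  also have "\<dots> = M_plus_I + M_plus_II"
    unfolding M_plus_I_eq M_plus_II_eq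
    by (simp add: fps_const_add[symmetric] fps_const_mult[symmetric] gf_add gf_mult
        weight_fps_const[abs_def] del: fps_const_add fps_const_mult)
  finally show ?thesis .
qed

section \<open>Specialisation at \<open>x = 0\<close>\<close>

lemma poly_weight: "poly (weight_I xy y R) 0 = weight_I 0 y' R"
  "poly (weight_II xy y R) 0 = weight_II 0 y' R"
  by (simp_all add: weight_I_def weight_II_def xy_def y_def y'_def poly_monom)

lemma at_x_0_gf:
  assumes "F = fps_const c * gf (\<lambda>R. fps_const (g R))"
  shows "at_x_0 F = fps_const (poly c 0) * gf (\<lambda>R. fps_const (poly (g R) 0))"
  unfolding assms gf_fps_const
  by (rule fps_ext) (simp add: at_x_0_def walk_sum_def poly_sum)

lemma at_x_0_M_plus:
  "at_x_0 M_plus_I = fps_const y' * gf_I 0 (fps_const y')"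
  "at_x_0 M_plus_II = gf_II 0 (fps_const y')"
proof -
  have "at_x_0 M_plus_I = fps_const (poly y 0) * gf (\<lambda>R. fps_const (poly (weight_I xy y R) 0))"
    by (rule at_x_0_gf) (simp add: M_plus_I_eq weight_fps_const[abs_def])
  also have "poly y 0 = y'" by (simp add: y_def y'_def poly_monom)
  finally show "at_x_0 M_plus_I = fps_const y' * gf_I 0 (fps_const y')"
    by (simp add: poly_weight weight_fps_const[symmetric])
  have "at_x_0 M_plus_II = fps_const (poly 1 0) * gf (\<lambda>R. fps_const (poly (weight_II xy y R) 0))"
    by (rule at_x_0_gf) (simp add: M_plus_II_eq weight_fps_const[abs_def])
  then show "at_x_0 M_plus_II = gf_II 0 (fps_const y')"
    by (simp add: poly_weight weight_fps_const[symmetric])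
qed

text \<open>Evaluation at \<open>x = 0\<close>, \<open>y = 1\<close> gives \<open>2\<close>,
  \<open>2\<close> and \<open>4\<close> for the three sums.\<close>

lemma y_nonzero: "y \<noteq> 0" "1 + y\<^sup>2 \<noteq> 0" "1 + y \<noteq> 0" "1 + y + 2 * y\<^sup>2 \<noteq> 0" "xy \<noteq> 0"
proof -
  have "poly (poly y 0) 1 = 1" by (simp add: y_def poly_monom)
  then have "poly (poly (1 + y\<^sup>2) 0) 1 \<noteq> 0" "poly (poly (1 + y) 0) 1 \<noteq> 0"
    "poly (poly (1 + y + 2 * y\<^sup>2) 0) 1 \<noteq> 0"
    by simp_all
  then show "1 + y\<^sup>2 \<noteq> 0" "1 + y \<noteq> 0" "1 + y + 2 * y\<^sup>2 \<noteq> 0" by (metis poly_0)+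
qed (simp_all add: y_def xy_def)

lemma y'_nonzero: "y' \<noteq> 0" "1 + y'\<^sup>2 \<noteq> 0" "1 + y' \<noteq> 0" "1 + y' + 2 * y'\<^sup>2 \<noteq> 0"
proof -
  have "poly y' 1 = 1" by (simp add: y'_def poly_monom)
  then have "poly (1 + y'\<^sup>2) 1 \<noteq> 0" "poly (1 + y') 1 \<noteq> 0" "poly (1 + y' + 2 * y'\<^sup>2) 1 \<noteq> 0"
    by simp_all
  then show "1 + y'\<^sup>2 \<noteq> 0" "1 + y' \<noteq> 0" "1 + y' + 2 * y'\<^sup>2 \<noteq> 0" by (metis poly_0)+
qed (simp add: y'_def)

lemma algebraic_M_plus: "algebraic_fps M_plus_I" "algebraic_fps M_plus_II"
  unfolding M_plus_I_eq M_plus_II_eq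
  by (intro fps.alg_mult algebraic_fps_const algebraic_gf_I y_nonzero)+

text \<open>These are boundary series over \<open>rat poly\<close>, to which the kernel method
  applies directly; no annihilating polynomial is specialised.\<close>

lemma algebraic_at_x_0_M_plus:
  "algebraic_fps (at_x_0 M_plus_I)" "algebraic_fps (at_x_0 M_plus_II)"
  unfolding at_x_0_M_plus
  by (intro fps.alg_mult algebraic_fps_const algebraic_gf_I_0 algebraic_gf_II_0 y'_nonzero)+

end

theorem theorem3p7:
  shows "algebraic_fps M_plus_I \<and> algebraic_fps M_plus_II
    \<and> M_plus = M_plus_I + M_plus_II \<and> algebraic_fps M_plus
    \<and> algebraic_fps (at_x_0 M_plus_I) \<and> algebraic_fps (at_x_0 M_plus_II)"
  using algebraic_M_plus algebraic_at_x_0_M_plus M_plus_eq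
    fps.alg_add[OF algebraic_M_plus] by simp

end
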